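(* Let $\mathcal{H}$ be a Hilbert space and let $T:\mathcal{H}\to\mathcal{H}$ be a bounded linear operator. If $T$ is posinormal and the range of $T$ is closed in $\mathcal{H}$, then for every integer $n\ge 1$ the operator $T^n$ is posinormal and the range of $T^n$ is closed in $\mathcal{H}$.
   Context: A bounded linear operator $A$ on a Hilbert space $\mathcal{H}$ is called posinormal if there exists a positive bounded linear operator $P$ on $\mathcal{H}$ (that is, $P$ is self-adjoint and $\langle Px,x\rangle\ge 0$ for all $x\in\mathcal{H}$) such that $AA^{*}=A^{*}PA$, where $A^*$ denotes the Hilbert-space adjoint of $A$. *)

theory Defs
  imports "HOL-Analysis.Analysis"
begin

text \<open>The scalar field of a Hilbert space is either the reals or the complex numbers. Both are
  covered by the following class. Up to isomorphism they are its only instances: every element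
  \<open>x\<close> is a root of the real polynomial \<open>(X - x) * (X - sconj x)\<close>.\<close>

class conj_field = real_normed_field +
  fixes sconj :: "'a \<Rightarrow> 'a"
  assumes sconj_add: "sconj (x + y) = sconj x + sconj y"
    and sconj_mult: "sconj (x * y) = sconj x * sconj y"
    and sconj_scaleR: "sconj (r *\<^sub>R x) = r *\<^sub>R sconj x"
    and sconj_sconj: "sconj (sconj x) = x"
    and mult_sconj: "x * sconj x = (norm x)\<^sup>2 *\<^sub>R 1"

instantiation real :: conj_field
begin
definition sconj_real :: "real \<Rightarrow> real" where "sconj_real x = x"
instance by standard (simp_all add: sconj_real_def power2_eq_square)
end

instantiation complex :: conj_field
begin
definition sconj_complex :: "complex \<Rightarrow> complex" where "sconj_complex = cnj"
instance by standard (simp_all add: sconj_complex_def complex_norm_square[symmetric] scaleR_conv_of_real)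
end

text \<open>Completeness and the topology come from the class \<^class>\<open>banach\<close> of the underlying type;
  the last assumption says that its norm is the one induced by the inner product, and
  also yields positive definiteness. The inner product is linear in its first argument.\<close>

locale hilbert_space = vector_space smul
  for smul :: "'k::conj_field \<Rightarrow> 'a::banach \<Rightarrow> 'a" +
  fixes ip :: "'a \<Rightarrow> 'a \<Rightarrow> 'k"
  assumes smul_of_real: "smul (of_real r) x = r *\<^sub>R x"
    and ip_add_left: "ip (x + y) z = ip x z + ip y z"
    and ip_smul_left: "ip (smul c x) y = c * ip x y"
    and ip_commute: "ip x y = sconj (ip y x)"
    and ip_self: "ip x x = of_real ((norm x)\<^sup>2)"

definition bounded_operator :: "('k::conj_field \<Rightarrow> 'a::banach \<Rightarrow> 'a) \<Rightarrow> ('a \<Rightarrow> 'a) \<Rightarrow> bool" where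
  "bounded_operator smul A \<longleftrightarrow>
     Vector_Spaces.linear smul smul A \<and> (\<exists>K. \<forall>x. norm (A x) \<le> K * norm x)"

text \<open>For a bounded operator on a Hilbert space, the described map exists by the Riesz
  representation theorem.\<close>

definition hadjoint :: "('a \<Rightarrow> 'a \<Rightarrow> 'k) \<Rightarrow> ('a \<Rightarrow> 'a) \<Rightarrow> 'a \<Rightarrow> 'a" where
  "hadjoint ip A = (THE B. \<forall>x y. ip (A x) y = ip x (B y))"

definition positive_operator ::
  "('k::conj_field \<Rightarrow> 'a::banach \<Rightarrow> 'a) \<Rightarrow> ('a \<Rightarrow> 'a \<Rightarrow> 'k) \<Rightarrow> ('a \<Rightarrow> 'a) \<Rightarrow> bool" where
  "positive_operator smul ip P \<longleftrightarrow>
     bounded_operator smul P \<and> hadjoint ip P = P \<and>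
     (\<forall>x. \<exists>r::real. r \<ge> 0 \<and> ip (P x) x = of_real r)"

definition posinormal ::
  "('k::conj_field \<Rightarrow> 'a::banach \<Rightarrow> 'a) \<Rightarrow> ('a \<Rightarrow> 'a \<Rightarrow> 'k) \<Rightarrow> ('a \<Rightarrow> 'a) \<Rightarrow> bool" where
  "posinormal smul ip A \<longleftrightarrow>
     bounded_operator smul A \<and>
     (\<exists>P. positive_operator smul ip P \<and>
          A \<circ> hadjoint ip A = hadjoint ip A \<circ> P \<circ> A)"

text \<open>Sanity checks: every complete real inner product space of the library is a Hilbert space in
  the above sense, and so is the complex line.\<close>

lemma hilbert_space_real:
  "hilbert_space scaleR (inner :: 'a::{real_inner,banach} \<Rightarrow> 'a \<Rightarrow> real)"
  by unfold_locales
    (simp_all add: sconj_real_def inner_add_left inner_commute power2_norm_eq_inner algebra_simps)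

lemma hilbert_space_complex: "hilbert_space (*) (\<lambda>x y::complex. x * cnj y)"
  by unfold_locales
    (simp_all add: sconj_complex_def scaleR_conv_of_real complex_norm_square[symmetric] algebra_simps
      flip: of_real_power)

end

theory Submission
  imports Defs
begin

text \<open>Posinormality of \<open>T\<close> gives \<open>ker T \<subseteq> ker T*\<close>, that is, \<open>ran T\<close> is orthogonal to \<open>ker T\<close>. If moreover
  \<open>ran T\<close> is closed, then \<open>T\<close> is bounded below on the orthogonal complement of \<open>ker T\<close>, which \<open>T\<close> maps
  into itself; hence \<open>ker (T ^^ n) = ker T\<close> and \<open>T ^^ n\<close> is bounded below on the same complement.
  Conversely, let \<open>A\<close> be bounded below on the complement of \<open>ker A\<close>, with \<open>ran A\<close> orthogonal to \<open>ker A\<close>.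
  Then \<open>A\<close> has closed range, and with the Moore-Penrose inverse \<open>G\<close> of \<open>A\<close> the operator \<open>S = A* G\<close>
  satisfies \<open>S A = A*\<close>, so \<open>A A* = A* (S* S) A\<close>.\<close>

context hilbert_space
begin

section \<open>Inner product algebra and the Cauchy-Schwarz inequality\<close>

lemma ip_zero_left [simp]: "ip 0 y = 0"
  using ip_add_left[of 0 0 y] by simp

lemma sconj_zero [simp]: "sconj (0::'k) = 0"
  using sconj_add[of "0::'k" 0] by simp

lemma ip_zero_right [simp]: "ip y 0 = 0"
  using ip_commute[of y 0] by simp

lemma ip_diff_left: "ip (x - y) z = ip x z - ip y z"
  using ip_add_left[of "x - y" y z] by simp

lemma ip_add_right: "ip z (x + y) = ip z x + ip z y"
  by (simp add: ip_commute[of z] ip_add_left sconj_add)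

lemma ip_diff_right: "ip z (x - y) = ip z x - ip z y"
  using ip_add_right[of z "x - y" y] by simp

lemma ip_smul_right: "ip x (smul c y) = sconj c * ip x y"
  by (simp add: ip_commute[of x] ip_smul_left sconj_mult)

lemma ip_eq_0_commute: "ip x y = 0 \<longleftrightarrow> ip y x = 0"
  by (metis ip_commute sconj_zero)

lemma ip_self_eq_0_iff [simp]: "ip x x = 0 \<longleftrightarrow> x = 0"
  by (simp add: ip_self)

lemma ip_eqI: "(\<And>z. ip z x = ip z y) \<Longrightarrow> x = y"
  using ip_diff_right[of "x - y" x y] by (metis eq_iff_diff_eq_0 ip_self_eq_0_iff)

lemma of_real_eq_cmult_sconj: "c * sconj c = of_real ((norm c)\<^sup>2)" for c :: 'k
  by (metis mult_sconj of_real_def)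

lemma norm_smul: "norm (smul c x) = norm c * norm x"
proof -
  have "of_real ((norm (smul c x))\<^sup>2) = (c * sconj c) * ip x x"
    by (simp only: ip_self[symmetric] ip_smul_left ip_smul_right) (simp add: algebra_simps)
  also have "\<dots> = of_real ((norm c * norm x)\<^sup>2)"
    by (simp add: of_real_eq_cmult_sconj ip_self power_mult_distrib)
  finally show ?thesis
    by (simp only: of_real_eq_iff) simp
qed

lemma pythagoras: "ip x y = 0 \<Longrightarrow> (norm (x + y))\<^sup>2 = (norm x)\<^sup>2 + (norm y)\<^sup>2"
  for x y :: 'a
proof -
  assume "ip x y = 0"
  then have "ip (x + y) (x + y) = ip x x + ip y y"
    using ip_eq_0_commute[of x y] by (simp add: ip_add_left ip_add_right)
  then have "of_real ((norm (x + y))\<^sup>2) = (of_real ((norm x)\<^sup>2 + (norm y)\<^sup>2) :: 'k)"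
    by (simp only: ip_self of_real_add)
  then show ?thesis by (simp only: of_real_eq_iff)
qed

lemma parallelogram: "(norm (x + y))\<^sup>2 + (norm (x - y))\<^sup>2 = 2 * (norm x)\<^sup>2 + 2 * (norm y)\<^sup>2"
  for x y :: 'a
proof -
  have "ip (x + y) (x + y) + ip (x - y) (x - y) = ip x x + ip x x + (ip y y + ip y y)"
    by (simp add: ip_add_left ip_add_right ip_diff_left ip_diff_right)
  then have "of_real ((norm (x + y))\<^sup>2 + (norm (x - y))\<^sup>2)
      = (of_real ((norm x)\<^sup>2 + (norm x)\<^sup>2 + ((norm y)\<^sup>2 + (norm y)\<^sup>2)) :: 'k)"
    by (simp only: ip_self of_real_add)
  then show ?thesis by (simp only: of_real_eq_iff)
qed

text \<open>\<open>smul c y\<close> is the orthogonal projection of \<open>w\<close> onto the line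
  through \<open>y\<close>, so Pythagoras splits \<open>w\<close>. Dropping the residual yields
  Cauchy-Schwarz; the same identity drives the variation argument in
  \<open>projection\<close>.\<close>

lemma norm_eq_residual:
  fixes w y
  defines "c \<equiv> ip w y / of_real ((norm y)\<^sup>2)"
  assumes "y \<noteq> 0"
  shows "(norm w)\<^sup>2 = (norm (w - smul c y))\<^sup>2 + (norm c)\<^sup>2 * (norm y)\<^sup>2"
proof -
  have "ip (w - smul c y) y = 0"
    using assms by (simp add: ip_diff_left ip_smul_left ip_self)
  then have "ip (w - smul c y) (smul c y) = 0"
    by (simp add: ip_smul_right)
  from pythagoras[OF this] show ?thesis
    by (simp add: norm_smul power_mult_distrib)
qed

lemma Cauchy_Schwarz: "norm (ip x y) \<le> norm x * norm y"
proof (cases "y = 0")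
  case False
  let ?c = "ip x y / of_real ((norm y)\<^sup>2)"
  have "(norm ?c * norm y)\<^sup>2 \<le> (norm x)\<^sup>2"
    using norm_eq_residual[OF False, of x] by (simp add: power_mult_distrib)
  then have "norm ?c * norm y \<le> norm x"
    by (rule power2_le_imp_le) simp
  moreover have "norm ?c * norm y = norm (ip x y) / norm y"
    using False by (simp add: norm_divide norm_mult power2_eq_square)
  ultimately have "norm (ip x y) / norm y \<le> norm x" by simp
  then show ?thesis
    using False by (simp add: divide_le_eq)
qed simp

lemma ip_scaleR_left: "ip (r *\<^sub>R x) y = r *\<^sub>R ip x y"
  by (metis ip_smul_left smul_of_real scaleR_conv_of_real)

lemma ip_scaleR_right: "ip x (r *\<^sub>R y) = r *\<^sub>R ip x y"
  by (simp add: ip_commute[of x] ip_scaleR_left sconj_scaleR)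

lemma bounded_bilinear_ip: "bounded_bilinear ip"
  by unfold_locales
    (auto simp: ip_add_left ip_add_right ip_scaleR_left ip_scaleR_right
      intro!: exI[of _ 1] Cauchy_Schwarz)

section \<open>Orthogonal projection and the Riesz representation theorem\<close>

lemma real_subspace_if_subspace: "subspace M \<Longrightarrow> real_vector.subspace M"
  by (metis smul_of_real real_vector.subspace_def subspace_def)

text \<open>A minimising sequence for the distance from \<open>x\<close> to \<open>M\<close> is
  Cauchy by the parallelogram law. Its limit attains the minimum, and since no move within
  \<open>M\<close> can shorten the residual, the residual is orthogonal to \<open>M\<close>.\<close>

lemma projection:
  assumes M: "subspace M" "closed M"
  obtains m where "m \<in> M" "\<And>y. y \<in> M \<Longrightarrow> ip (x - m) y = 0"
proof -
  define D where "D = (INF y\<in>M. (norm (x - y))\<^sup>2)"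
  have ne: "M \<noteq> {}" using subspace_0[OF M(1)] by auto
  have bdd: "bdd_below ((\<lambda>y. (norm (x - y))\<^sup>2) ` M)"
    by (rule bdd_belowI[of _ 0]) auto
  have D_le: "D \<le> (norm (x - y))\<^sup>2" if "y \<in> M" for y
    unfolding D_def by (rule cINF_lower[OF bdd that])
  have "\<exists>y\<in>M. (norm (x - y))\<^sup>2 < D + inverse (real (Suc n))" for n
    using cINF_less_iff[OF ne bdd, of "D + inverse (real (Suc n))"] by (simp add: D_def)
  then obtain u where u: "\<And>n. u n \<in> M" "\<And>n. (norm (x - u n))\<^sup>2 < D + inverse (real (Suc n))"
    by metis
  \<comment> \<open>The midpoint of \<open>u i\<close> and \<open>u j\<close> lies in
    \<open>M\<close>, so the squared norm of the sum of the two residuals is at least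
    \<open>4 * D\<close>; this cancels the two terms \<open>2 * D\<close> on the right of the
    parallelogram law.\<close>
  have dist_u: "(dist (u i) (u j))\<^sup>2 \<le> 2 * inverse (real (Suc i)) + 2 * inverse (real (Suc j))" for i j
  proof -
    have half: "(1/2) *\<^sub>R (u i + u j) \<in> M"
      using M(1) u(1) by (metis smul_of_real subspace_add subspace_scale)
    have "(x - u i) + (x - u j) = 2 *\<^sub>R (x - (1/2) *\<^sub>R (u i + u j))"
      by (simp add: scaleR_2 algebra_simps flip: scaleR_add_left)
    then have "(norm ((x - u i) + (x - u j)))\<^sup>2 = 4 * (norm (x - (1/2) *\<^sub>R (u i + u j)))\<^sup>2"
      by (simp only: norm_scaleR power_mult_distrib) simp
    moreover have "norm ((x - u i) - (x - u j)) = dist (u i) (u j)"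
      by (simp add: dist_norm norm_minus_commute)
    ultimately show ?thesis
      using parallelogram[of "x - u i" "x - u j"] D_le[OF half] u(2)[of i] u(2)[of j] by simp
  qed
  have "Cauchy u"
  proof (rule metric_CauchyI)
    fix e :: real assume "e > 0"
    then obtain N where N: "inverse (real (Suc N)) < e\<^sup>2 / 4"
      using reals_Archimedean[of "e\<^sup>2/4"] by auto
    have "dist (u i) (u j) < e" if "i \<ge> N" "j \<ge> N" for i j
    proof -
      have "inverse (real (Suc i)) \<le> inverse (real (Suc N))" "inverse (real (Suc j)) \<le> inverse (real (Suc N))"
        using that by auto
      with N dist_u[of i j] have "(dist (u i) (u j))\<^sup>2 < e\<^sup>2" by linarith
      then show ?thesis using \<open>e > 0\<close> by (simp add: power2_less_imp_less)
    qed
    then show "\<exists>N. \<forall>i\<ge>N. \<forall>j\<ge>N. dist (u i) (u j) < e" by blast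
  qed
  then obtain m where m: "u \<longlonglongrightarrow> m"
    using Cauchy_convergent convergent_def by blast
  have mM: "m \<in> M" using closed_sequentially[OF M(2)] u(1) m by blast
  have m_le: "(norm (x - m))\<^sup>2 \<le> D"
  proof (rule LIMSEQ_le)
    show "(\<lambda>n. (norm (x - u n))\<^sup>2) \<longlonglongrightarrow> (norm (x - m))\<^sup>2"
      by (intro tendsto_intros m)
    show "(\<lambda>n. D + inverse (real (Suc n))) \<longlonglongrightarrow> D"
      using tendsto_add[OF tendsto_const[of D] LIMSEQ_inverse_real_of_nat] by simp
  qed (use u(2) less_imp_le in blast)
  show thesis
  proof (rule that[OF mM])
    fix y assume y: "y \<in> M"
    show "ip (x - m) y = 0"
    proof (cases "y = 0")
      case False
      let ?c = "ip (x - m) y / of_real ((norm y)\<^sup>2)"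
      \<comment> \<open>Moving from \<open>m\<close> by \<open>smul ?c y\<close> lowers the squared
        distance by \<open>(norm ?c)\<^sup>2 * (norm y)\<^sup>2\<close>, which must vanish because
        \<open>m\<close> is already optimal.\<close>
      have "m + smul ?c y \<in> M" using M(1) mM y by (simp add: subspace_add subspace_scale)
      from D_le[OF this] have "D \<le> (norm (x - m - smul ?c y))\<^sup>2" by (simp add: diff_diff_eq)
      with m_le norm_eq_residual[OF False, of "x - m"] have "(norm ?c)\<^sup>2 * (norm y)\<^sup>2 \<le> 0" by linarith
      then have "?c = 0"
        using False by (simp add: mult_le_0_iff)
      then show ?thesis using False by simp
    qed simp
  qed
qed

text \<open>Unless \<open>f\<close> vanishes, its kernel has codimension one, so a vector orthogonal
  to the kernel represents \<open>f\<close> after rescaling.\<close>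

lemma Riesz:
  fixes f :: "'a \<Rightarrow> 'k"
  assumes add: "\<And>x y. f (x + y) = f x + f y"
    and smul: "\<And>c x. f (smul c x) = c * f x"
    and bound: "\<And>x. norm (f x) \<le> norm x * K"
  obtains z where "\<And>x. f x = ip x z"
proof (cases "\<forall>x. f x = 0")
  case True
  then show thesis using that[of 0] by simp
next
  case False
  then obtain a where a: "f a \<noteq> 0" by blast
  have f: "bounded_linear f"
    using add bound by (intro bounded_linear_intro[of f K])
      (simp_all add: smul scaleR_conv_of_real flip: smul_of_real)
  interpret f: bounded_linear f by fact
  define M where "M = {x. f x = 0}"
  have "subspace M"
    unfolding M_def subspace_def by (auto simp: add smul f.zero)
  moreover have "closed M"
    unfolding M_def by (intro closed_Collect_eq continuous_intros f.continuous_on)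
  ultimately obtain m where m: "m \<in> M" "\<And>y. y \<in> M \<Longrightarrow> ip (a - m) y = 0"
    by (rule projection[where x = a]) blast
  define w where "w = a - m"
  have fw: "f w \<noteq> 0" using a m(1) by (simp add: w_def f.diff M_def)
  then have w0: "w \<noteq> 0" using f.zero by auto
  \<comment> \<open>The scalar makes both sides agree at \<open>x = w\<close>; it is conjugated
    because \<open>ip\<close> is conjugate-linear in its second argument.\<close>
  have "f x = ip x (smul (sconj (f w / of_real ((norm w)\<^sup>2))) w)" for x
  proof -
    have "x - smul (f x / f w) w \<in> M"
      using fw by (simp add: M_def f.diff smul)
    then have "ip (x - smul (f x / f w) w) w = 0"
      using m(2) ip_eq_0_commute w_def by blast
    then have "ip x w = f x / f w * of_real ((norm w)\<^sup>2)"
      by (simp add: ip_diff_left ip_smul_left ip_self)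
    then show ?thesis using fw w0 by (simp add: ip_smul_right sconj_sconj)
  qed
  then show thesis by (rule that)
qed

section \<open>Bounded operators and their adjoints\<close>

lemma bounded_operator_iff:
  "bounded_operator smul A \<longleftrightarrow>
     (\<forall>x y. A (x + y) = A x + A y) \<and> (\<forall>c x. A (smul c x) = smul c (A x)) \<and>
     (\<exists>K. \<forall>x. norm (A x) \<le> K * norm x)"
  using vector_space_axioms by (auto simp: bounded_operator_def Vector_Spaces.linear_iff)

lemma bounded_operator_imp_bounded_linear:
  assumes "bounded_operator smul A"
  shows "bounded_linear A"
proof -
  from assms obtain K where "\<And>x. norm (A x) \<le> K * norm x"
    by (auto simp: bounded_operator_iff)
  with assms show ?thesis
    by (intro bounded_linear_intro[of A K])
      (auto simp: bounded_operator_iff mult.commute simp flip: smul_of_real)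
qed

lemma bounded_operator_comp:
  assumes "bounded_operator smul A" "bounded_operator smul B"
  shows "bounded_operator smul (A \<circ> B)"
proof -
  have "bounded_linear (\<lambda>x. A (B x))"
    by (rule bounded_linear_compose[OF assms[THEN bounded_operator_imp_bounded_linear]])
  then obtain K where "\<And>x. norm (A (B x)) \<le> norm x * K"
    using bounded_linear.bounded by blast
  with assms show ?thesis
    by (auto simp: bounded_operator_iff mult.commute intro!: exI[of _ K])
qed

lemma bounded_operator_funpow: "bounded_operator smul A \<Longrightarrow> bounded_operator smul (A ^^ n)"
  by (induction n) (auto simp: bounded_operator_comp bounded_operator_iff[of id] intro!: exI[of _ 1])

text \<open>Riesz, applied to \<open>\<lambda>x. ip (A x) y\<close> for each \<open>y\<close>,
  supplies existence, and \<open>ip_eqI\<close> uniqueness, so the definite description in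
  \<open>hadjoint\<close> denotes the adjoint.\<close>

lemma hadjoint:
  assumes A: "bounded_operator smul A"
  shows "ip (A x) y = ip x (hadjoint ip A y)"
proof -
  interpret A: bounded_linear A by (rule bounded_operator_imp_bounded_linear[OF A])
  obtain K where K: "\<And>x. norm (A x) \<le> norm x * K" using A.bounded by blast
  have "\<exists>z. \<forall>x. ip (A x) y = ip x z" for y
  proof -
    have "norm (ip (A x) y) \<le> norm x * (K * norm y)" for x
      using Cauchy_Schwarz[of "A x" y] mult_right_mono[OF K[of x], of "norm y"]
      by (simp add: mult.assoc)
    with A obtain z where "\<And>x. ip (A x) y = ip x z"
      using Riesz[of "\<lambda>x. ip (A x) y" "K * norm y"]
      by (auto simp: bounded_operator_iff ip_add_left ip_smul_left)
    then show ?thesis by blast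
  qed
  then obtain B where B: "\<forall>x y. ip (A x) y = ip x (B y)" by metis
  then have "B' = B" if "\<forall>x y. ip (A x) y = ip x (B' y)" for B'
    using that by (intro ext ip_eqI) metis
  with B have "\<forall>x y. ip (A x) y = ip x (hadjoint ip A y)"
    unfolding hadjoint_def by (rule theI[where P = "\<lambda>B. \<forall>x y. ip (A x) y = ip x (B y)"])
  then show ?thesis by blast
qed

lemma hadjoint_left:
  "bounded_operator smul A \<Longrightarrow> ip (hadjoint ip A x) y = ip x (A y)"
  using hadjoint[of A y x] by (metis ip_commute)

lemma hadjoint_eqI:
  assumes "\<And>x y. ip (A x) y = ip x (B y)"
  shows "hadjoint ip A = B"
  unfolding hadjoint_def using assms by (intro the_equality ext ip_eqI) metis+

lemma bounded_operator_hadjoint: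
  assumes A: "bounded_operator smul A"
  shows "bounded_operator smul (hadjoint ip A)"
  unfolding bounded_operator_iff
proof (intro conjI allI)
  let ?B = "hadjoint ip A"
  show "?B (x + y) = ?B x + ?B y" for x y
    by (rule ip_eqI) (simp add: ip_add_right flip: hadjoint[OF A])
  show "?B (smul c x) = smul c (?B x)" for c x
    by (rule ip_eqI) (simp add: ip_smul_right flip: hadjoint[OF A])
  interpret A: bounded_linear A by (rule bounded_operator_imp_bounded_linear[OF A])
  obtain K where K: "\<And>x. norm (A x) \<le> norm x * K" using A.bounded by blast
  have "norm (?B x) \<le> K * norm x" for x
  proof (cases "?B x = 0")
    case True
    have "0 \<le> norm x * K" using K[of x] norm_ge_zero order_trans by blast
    with True show ?thesis by (simp add: mult.commute)
  next
    case False
    have "norm (?B x) * norm (?B x) = norm (ip (?B x) (?B x))"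
      by (simp add: ip_self power2_eq_square norm_mult)
    also have "\<dots> = norm (ip (A (?B x)) x)" by (simp add: hadjoint[OF A])
    also have "\<dots> \<le> norm (A (?B x)) * norm x" by (rule Cauchy_Schwarz)
    also have "\<dots> \<le> norm (?B x) * K * norm x" by (intro mult_right_mono K) simp
    finally show ?thesis using False by (simp add: mult.assoc)
  qed
  then show "\<exists>K. \<forall>x. norm (?B x) \<le> K * norm x" by blast
qed

section \<open>Uniform boundedness and closed ranges\<close>

lemma weakly_bounded_imp_bounded:
  assumes "\<And>v. \<exists>K. \<forall>w\<in>W. norm (ip v w) \<le> K"
  obtains C where "C > 0" "\<And>w. w \<in> W \<Longrightarrow> norm w \<le> C"
proof -
  \<comment> \<open>Baire category argument: the closed sets \<open>E k\<close> exhaust the space by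
    the pointwise bounds, so one of them contains a ball.\<close>
  define E where "E k = {v. \<forall>w\<in>W. norm (ip v w) \<le> real k}" for k
  have closed_E: "closed (E k)" for k
  proof -
    have "closed {v. norm (ip v w) \<le> real k}" for w
      by (intro closed_Collect_le continuous_intros
          bounded_linear.continuous_on[OF bounded_bilinear.bounded_linear_left[OF bounded_bilinear_ip]])
    then have "closed (\<Inter>w\<in>W. {v. norm (ip v w) \<le> real k})" by blast
    moreover have "E k = (\<Inter>w\<in>W. {v. norm (ip v w) \<le> real k})" by (auto simp: E_def)
    ultimately show ?thesis by simp
  qed
  have "\<exists>k. v \<in> E k" for v
  proof -
    obtain K where "\<forall>w\<in>W. norm (ip v w) \<le> K" using assms by blast
    moreover obtain k where "K \<le> real k" using real_arch_simple by blast
    ultimately have "v \<in> E k" unfolding E_def by (blast intro: order_trans)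
    then show ?thesis by blast
  qed
  then have UN_E: "(\<Union>k. E k) = UNIV" by blast
  have "\<exists>k. interior (E k) \<noteq> {}"
  proof (rule ccontr)
    assume "\<not> ?thesis"
    then have "Met_TC.mtopology interior_of \<Union> (range E) = {}"
      using closed_E complete_UNIV
      by (intro Met_TC.metric_Baire_category_alt) auto
    then show False using UN_E by simp
  qed
  then obtain k v0 r where r: "r > 0" "ball v0 r \<subseteq> E k"
    by (metis ex_in_conv mem_interior)
  \<comment> \<open>Subtracting the bounds at \<open>v0 + u\<close> and \<open>v0\<close>, where
    \<open>u\<close> is parallel to \<open>w\<close> with norm \<open>r / 2\<close>, gives
    \<open>r / 2 * norm w \<le> 2 * real k\<close>. The summand 1 keeps the constant positive even
    for \<open>k = 0\<close>.\<close>
  have "norm w \<le> 4 * real k / r + 1" if w: "w \<in> W" for w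
  proof (cases "w = 0")
    case False
    define u where "u = (r / 2 / norm w) *\<^sub>R w"
    have "norm u < r" using r(1) False by (simp add: u_def)
    then have "v0 + u \<in> E k" "v0 \<in> E k"
      using r by (auto simp: subset_iff dist_norm)
    then have "norm (ip (v0 + u) w) \<le> real k" "norm (ip v0 w) \<le> real k"
      using w by (auto simp: E_def)
    then have "norm (ip u w) \<le> 2 * real k"
      using norm_triangle_ineq4[of "ip (v0 + u) w" "ip v0 w"] by (simp add: ip_add_left)
    moreover have "norm (ip u w) = r / 2 * norm w"
      using r(1) False by (simp add: u_def ip_scaleR_left ip_self norm_mult power2_eq_square)
    ultimately show ?thesis using r(1) by (simp add: field_simps)
  qed (use r in simp)
  moreover have "4 * real k / r + 1 > 0" using r(1) by (simp add: add_nonneg_pos)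
  ultimately show thesis using that by blast
qed

lemma subspace_range: "bounded_operator smul A \<Longrightarrow> subspace (range A)"
  unfolding subspace_def bounded_operator_iff
  by (metis (no_types, opaque_lifting) add_0_right add_left_cancel rangeE rangeI)

text \<open>The lower bound pulls Cauchy sequences in the image back to Cauchy sequences in the
  complete set \<open>M\<close>, so the image is complete.\<close>

lemma closed_image_if_bounded_below:
  assumes A: "bounded_operator smul A"
    and M: "subspace M" "closed M"
    and C: "C > 0" "\<And>x. x \<in> M \<Longrightarrow> norm x \<le> C * norm (A x)"
  shows "closed (A ` M)"
proof -
  have "complete (A ` M)"
  proof (rule complete_isometric_image[where e = "1 / C"])
    show "\<forall>x\<in>M. 1 / C * norm x \<le> norm (A x)"
      using C by (simp add: field_simps)
    show "complete M" using M(2) complete_eq_closed by blast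
  qed (use assms in \<open>simp_all add: real_subspace_if_subspace bounded_operator_imp_bounded_linear\<close>)
  then show ?thesis by (simp add: complete_imp_closed)
qed

text \<open>The adjoint is treated first because its image of \<open>range A\<close> is then closed,
  which lets \<open>closed_range_imp_bounded_below\<close> project onto that image.\<close>

lemma hadjoint_bounded_below_on_range:
  assumes A: "bounded_operator smul A" and closed: "closed (range A)"
  obtains C where "C > 0" "\<And>w. w \<in> range A \<Longrightarrow> norm w \<le> C * norm (hadjoint ip A w)"
proof -
  let ?B = "hadjoint ip A"
  interpret B: bounded_linear ?B
    by (intro bounded_operator_imp_bounded_linear bounded_operator_hadjoint A)
  \<comment> \<open>\<open>W\<close> is weakly bounded: only the component \<open>A u\<close> of \<open>v\<close> in \<open>ran A\<close> matters, and
    \<open>\<langle>A u, w\<rangle> = \<langle>u, A* w\<rangle>\<close>. This replaces the open mapping theorem by uniform boundedness.\<close>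
  define W where "W = {w \<in> range A. norm (?B w) \<le> 1}"
  have "\<exists>K. \<forall>w\<in>W. norm (ip v w) \<le> K" for v
  proof -
    obtain m where "m \<in> range A" and m: "\<And>y. y \<in> range A \<Longrightarrow> ip (v - m) y = 0"
      using projection[OF subspace_range[OF A] closed, where x = v] by blast
    then obtain u where u: "m = A u" by blast
    have "norm (ip v w) \<le> norm u" if "w \<in> W" for w
    proof -
      have "ip v w = ip u (?B w)"
        using m[of w] that by (simp add: W_def ip_diff_left u hadjoint[OF A])
      then have "norm (ip v w) \<le> norm u * norm (?B w)"
        using Cauchy_Schwarz by simp
      also have "\<dots> \<le> norm u * 1"
        using that by (intro mult_left_mono) (auto simp: W_def)
      finally show ?thesis by simp
    qed
    then show ?thesis by blast
  qed
  then obtain C where C: "C > 0" "\<And>w. w \<in> W \<Longrightarrow> norm w \<le> C"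
    using weakly_bounded_imp_bounded by metis
  have "norm w \<le> C * norm (?B w)" if w: "w \<in> range A" for w
  proof (cases "?B w = 0")
    case True
    obtain u where "w = A u" using w by blast
    then have "ip w w = 0" using True hadjoint[OF A, of u w] by simp
    then show ?thesis by simp
  next
    case False
    define r where "r = 1 / norm (?B w)"
    have "r *\<^sub>R w \<in> W"
      using False real_vector.subspace_scale[OF real_subspace_if_subspace[OF subspace_range[OF A]] w]
      by (simp add: W_def B.scaleR r_def)
    from C(2)[OF this] show ?thesis
      using False by (simp add: r_def divide_le_eq)
  qed
  with C(1) show thesis by (rule that)
qed

section \<open>Lower bounds on the orthogonal complement of the kernel\<close>

definition orth_ker :: "('a \<Rightarrow> 'a) \<Rightarrow> 'a set" where
  "orth_ker A = {x. \<forall>z. A z = 0 \<longrightarrow> ip x z = 0}"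

lemma subspace_orth_ker: "subspace (orth_ker A)"
  by (auto simp: subspace_def orth_ker_def ip_add_left ip_smul_left)

lemma closed_orth_ker: "closed (orth_ker A)"
proof -
  have "closed {x. A z = 0 \<longrightarrow> ip x z = 0}" for z
    by (cases "A z = 0")
      (auto intro!: closed_Collect_eq continuous_intros
        bounded_linear.continuous_on[OF bounded_bilinear.bounded_linear_left[OF bounded_bilinear_ip]])
  then have "closed (\<Inter>z. {x. A z = 0 \<longrightarrow> ip x z = 0})" by blast
  moreover have "orth_ker A = (\<Inter>z. {x. A z = 0 \<longrightarrow> ip x z = 0})"
    by (auto simp: orth_ker_def)
  ultimately show ?thesis by simp
qed

lemma orth_ker_Int_ker: "x \<in> orth_ker A \<Longrightarrow> A x = 0 \<Longrightarrow> x = 0"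
  unfolding orth_ker_def using ip_self_eq_0_iff by blast

text \<open>Subtracting from \<open>x\<close> its projection onto the kernel leaves
  \<open>A x\<close> unchanged.\<close>

lemma orth_ker_decomposition:
  assumes A: "bounded_operator smul A"
  obtains x' where "x' \<in> orth_ker A" "A x' = A x"
proof -
  interpret A: bounded_linear A by (rule bounded_operator_imp_bounded_linear[OF A])
  have "subspace {z. A z = 0}"
    using A by (auto simp: subspace_def bounded_operator_iff A.zero)
  moreover have "closed {z. A z = 0}"
    by (intro closed_Collect_eq continuous_intros A.continuous_on)
  ultimately obtain m where "m \<in> {z. A z = 0}" "\<And>z. z \<in> {z. A z = 0} \<Longrightarrow> ip (x - m) z = 0"
    by (rule projection[where x = x]) blast
  then show thesis
    using that[of "x - m"] by (simp add: orth_ker_def A.diff)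
qed

text \<open>Every \<open>x\<close> in \<open>orth_ker A\<close> turns out to be \<open>?B w\<close>
  with \<open>w\<close> in \<open>range A\<close>. Then the square of \<open>norm x\<close> is the
  norm of \<open>ip (A x) w\<close>, and the lower bound for the adjoint at \<open>w\<close> yields
  the same constant \<open>C\<close> for \<open>A\<close>.\<close>

lemma closed_range_imp_bounded_below:
  assumes A: "bounded_operator smul A" and closed: "closed (range A)"
  obtains C where "C > 0" "\<And>x. x \<in> orth_ker A \<Longrightarrow> norm x \<le> C * norm (A x)"
proof -
  let ?B = "hadjoint ip A"
  interpret A: bounded_linear A by (rule bounded_operator_imp_bounded_linear[OF A])
  have B: "bounded_operator smul ?B" by (rule bounded_operator_hadjoint[OF A])
  obtain C where C: "C > 0" "\<And>w. w \<in> range A \<Longrightarrow> norm w \<le> C * norm (?B w)"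
    using hadjoint_bounded_below_on_range[OF assms] by blast
  define D where "D = ?B ` range A"
  have "closed D"
    unfolding D_def using C by (rule closed_image_if_bounded_below[OF B subspace_range[OF A] closed])
  moreover have "subspace D"
    using subspace_range[OF bounded_operator_comp[OF B A]] by (simp add: D_def image_comp)
  ultimately have proj: "\<exists>d\<in>D. \<forall>y\<in>D. ip (x - d) y = 0" for x
    using projection[where x = x] by metis
  have "norm x \<le> C * norm (A x)" if x: "x \<in> orth_ker A" for x
  proof -
    obtain d where d: "d \<in> D" "\<And>y. y \<in> D \<Longrightarrow> ip (x - d) y = 0"
      using proj by blast
    then obtain w where w: "w \<in> range A" "d = ?B w" by (auto simp: D_def)
    \<comment> \<open>The residual \<open>x - d\<close> is orthogonal to
      \<open>?B (A (x - d))\<close>, an element of \<open>D\<close>, so it lies in the kernel. Being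
      orthogonal to both \<open>x\<close> and \<open>d\<close>, it is zero.\<close>
    have "ip (A (x - d)) (A (x - d)) = 0"
      unfolding hadjoint[OF A] by (rule d(2)) (simp add: D_def)
    then have ker: "A (x - d) = 0" by simp
    then have "ip x (x - d) = 0" using x by (simp add: orth_ker_def)
    moreover have "ip d (x - d) = 0" using d ip_eq_0_commute by blast
    ultimately have "ip (x - d) (x - d) = 0" by (simp add: ip_diff_left)
    then have xd: "x = ?B w" using w by simp
    have "norm x * norm x = norm (ip x (?B w))"
      by (simp add: ip_self norm_mult power2_eq_square flip: xd)
    also have "\<dots> = norm (ip (A x) w)" by (simp add: hadjoint[OF A])
    also have "\<dots> \<le> norm (A x) * norm w" by (rule Cauchy_Schwarz)
    also have "\<dots> \<le> norm (A x) * (C * norm x)"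
      using C(2)[OF w(1)] by (intro mult_left_mono) (simp_all flip: xd)
    finally show ?thesis
      using C(1) by (cases "x = 0") (simp_all add: mult_ac)
  qed
  with C(1) show thesis by (rule that)
qed

lemma bounded_below_imp_closed_range:
  assumes A: "bounded_operator smul A"
    and C: "C > 0" "\<And>x. x \<in> orth_ker A \<Longrightarrow> norm x \<le> C * norm (A x)"
  shows "closed (range A)"
proof -
  have "A x \<in> A ` orth_ker A" for x
    using orth_ker_decomposition[OF A, of x] by (metis imageI)
  then have "range A = A ` orth_ker A" by blast
  then show ?thesis
    using closed_image_if_bounded_below[OF A subspace_orth_ker closed_orth_ker C] by simp
qed

section \<open>The Moore-Penrose inverse\<close>

lemma pseudo_inverse:
  assumes A: "bounded_operator smul A"
    and C: "C > 0" "\<And>x. x \<in> orth_ker A \<Longrightarrow> norm x \<le> C * norm (A x)"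
  obtains G where "bounded_operator smul G" "\<And>x. A (G (A x)) = A x"
proof -
  interpret A: bounded_linear A by (rule bounded_operator_imp_bounded_linear[OF A])
  \<comment> \<open>\<open>R y x\<close>: \<open>x\<close> is the least-squares solution of \<open>A x = y\<close> of minimal norm, so \<open>G\<close> below is the
    Moore-Penrose inverse.\<close>
  define R where "R y x \<longleftrightarrow> x \<in> orth_ker A \<and> (\<forall>z. ip (y - A x) (A z) = 0)" for y x
  have "\<exists>x. R y x" for y
  proof -
    obtain m where m: "m \<in> range A" "\<And>z. z \<in> range A \<Longrightarrow> ip (y - m) z = 0"
      using projection[OF subspace_range[OF A] bounded_below_imp_closed_range[OF assms], where x = y]
      by blast
    obtain u where "m = A u" using m(1) by blast
    with m(2) orth_ker_decomposition[OF A, of u] show ?thesis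
      unfolding R_def by (metis rangeI)
  qed
  then obtain G where G: "\<And>y. R y (G y)" by metis
  \<comment> \<open>Uniqueness makes the chosen \<open>G\<close> linear: it is enough that sums and
    multiples of solutions again satisfy \<open>R\<close>.\<close>
  have unique: "x = x'" if "R y x" "R y x'" for x x' y
  proof -
    have "ip (A (x - x')) (A z) = 0" for z
      using that by (simp add: R_def A.diff ip_diff_left)
    then have "A (x - x') = 0" using ip_self_eq_0_iff by blast
    moreover have "x - x' \<in> orth_ker A"
      using that by (simp add: R_def subspace_diff[OF subspace_orth_ker])
    ultimately show ?thesis using orth_ker_Int_ker by force
  qed
  have "bounded_operator smul G"
    unfolding bounded_operator_iff
  proof (intro conjI allI)
    show "G (y + y') = G y + G y'" for y y'
    proof (rule unique[OF G])
      have "ip (y - A (G y)) (A z) = 0" "ip (y' - A (G y')) (A z) = 0" for z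
        using G[of y] G[of y'] by (auto simp: R_def)
      then show "R (y + y') (G y + G y')"
        using G[of y] G[of y']
        by (simp add: R_def subspace_add[OF subspace_orth_ker] A.add ip_diff_left ip_add_left)
    qed
    show "G (smul c y) = smul c (G y)" for c y
    proof (rule unique[OF G])
      have "ip (y - A (G y)) (A z) = 0" for z
        using G[of y] by (auto simp: R_def)
      then show "R (smul c y) (smul c (G y))"
        using G[of y] A
        by (simp add: R_def subspace_scale[OF subspace_orth_ker] bounded_operator_iff
            ip_diff_left ip_smul_left)
    qed
    have "norm (G y) \<le> C * norm y" for y
    proof -
      have "ip (y - A (G y)) (A (G y)) = 0" using G[of y] by (simp add: R_def)
      \<comment> \<open>\<open>y\<close> is the orthogonal sum of \<open>A (G y)\<close> and the
        residual, so \<open>A (G y)\<close> is no longer than \<open>y\<close>; the lower bound on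
        \<open>orth_ker A\<close> then gives the constant \<open>C\<close>.\<close>
      from pythagoras[OF this] have "(norm (A (G y)))\<^sup>2 \<le> (norm y)\<^sup>2" by simp
      then have "norm (A (G y)) \<le> norm y" by (rule power2_le_imp_le) simp
      then have "C * norm (A (G y)) \<le> C * norm y" using C(1) by simp
      with C(2)[of "G y"] G[of y] show ?thesis by (simp add: R_def)
    qed
    then show "\<exists>K. \<forall>y. norm (G y) \<le> K * norm y" by blast
  qed
  moreover have "A (G (A x)) = A x" for x
  proof -
    have "ip (A (x - G (A x))) (A z) = 0" for z
      using G[of "A x"] by (simp add: R_def A.diff)
    then have "A (x - G (A x)) = 0" using ip_self_eq_0_iff by blast
    then show ?thesis by (simp add: A.diff)
  qed
  ultimately show thesis by (rule that)
qed

section \<open>Posinormality and orthogonality of range and kernel\<close>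

lemma positive_operator_hadjoint_comp:
  assumes S: "bounded_operator smul S"
  shows "positive_operator smul ip (hadjoint ip S \<circ> S)"
  unfolding positive_operator_def
proof (intro conjI allI)
  show "bounded_operator smul (hadjoint ip S \<circ> S)"
    by (intro bounded_operator_comp bounded_operator_hadjoint S)
  show "hadjoint ip (hadjoint ip S \<circ> S) = hadjoint ip S \<circ> S"
    by (rule hadjoint_eqI) (simp add: hadjoint_left[OF S] hadjoint[OF S])
  show "\<exists>r::real. r \<ge> 0 \<and> ip ((hadjoint ip S \<circ> S) x) x = of_real r" for x
    by (rule exI[of _ "(norm (S x))\<^sup>2"]) (simp add: hadjoint_left[OF S] ip_self)
qed

text \<open>From \<open>T x = 0\<close> follows \<open>T (?B x) = ?B (P (T x)) = 0\<close>, so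
  \<open>ip (?B x) (?B x) = ip (T (?B x)) x = 0\<close>. Thus the adjoint kills
  \<open>x\<close>.\<close>

lemma posinormal_ker_orth_range:
  assumes T: "posinormal smul ip T" and "T x = 0"
  shows "ip (T z) x = 0"
proof -
  let ?B = "hadjoint ip T"
  obtain P where bT: "bounded_operator smul T" and bP: "bounded_operator smul P"
    and P: "T \<circ> ?B = ?B \<circ> P \<circ> T"
    using T by (auto simp: posinormal_def positive_operator_def)
  have "T (?B x) = ?B (P (T x))" using P by (metis comp_apply)
  also have "\<dots> = 0"
    using \<open>T x = 0\<close> bounded_operator_imp_bounded_linear[OF bP]
      bounded_operator_imp_bounded_linear[OF bounded_operator_hadjoint[OF bT]]
    by (simp add: linear_simps)
  finally have "ip (?B x) (?B x) = 0" by (simp flip: hadjoint[OF bT])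
  then show ?thesis by (simp add: hadjoint[OF bT])
qed

lemma posinormal_if_ker_orth_range:
  assumes A: "bounded_operator smul A"
    and C: "C > 0" "\<And>x. x \<in> orth_ker A \<Longrightarrow> norm x \<le> C * norm (A x)"
    and orth: "\<And>x z. A x = 0 \<Longrightarrow> ip (A z) x = 0"
  shows "posinormal smul ip A"
proof -
  let ?B = "hadjoint ip A"
  interpret A: bounded_linear A by (rule bounded_operator_imp_bounded_linear[OF A])
  interpret B: bounded_linear ?B
    by (intro bounded_operator_imp_bounded_linear bounded_operator_hadjoint A)
  obtain G where G: "bounded_operator smul G" "\<And>x. A (G (A x)) = A x"
    using pseudo_inverse[OF A C] by blast
  define S where "S = ?B \<circ> G"
  have S: "bounded_operator smul S"
    unfolding S_def by (intro bounded_operator_comp bounded_operator_hadjoint A G)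
  have SA: "S (A x) = ?B x" for x
  proof -
    \<comment> \<open>\<open>G (A x)\<close> and \<open>x\<close> differ by a kernel element, and by
      \<open>orth\<close> the adjoint vanishes on the kernel.\<close>
    have "A (G (A x) - x) = 0" by (simp add: A.diff G)
    then have "ip z (?B (G (A x) - x)) = 0" for z
      using orth by (simp flip: hadjoint[OF A])
    then have "?B (G (A x) - x) = 0" using ip_self_eq_0_iff by blast
    then show ?thesis by (simp add: S_def B.diff)
  qed
  \<comment> \<open>Tested against \<open>z\<close>, both sides become
    \<open>ip (?B z) (?B x)\<close>, the right one by applying \<open>SA\<close> to \<open>z\<close>
    and to \<open>x\<close>.\<close>
  have "A (?B x) = ?B (hadjoint ip S (S (A x)))" for x
    by (rule ip_eqI) (simp add: SA flip: hadjoint[OF A] hadjoint[OF S] hadjoint_left[OF A])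
  then show ?thesis
    unfolding posinormal_def using A positive_operator_hadjoint_comp[OF S] by (auto simp: fun_eq_iff)
qed

section \<open>Passage to powers\<close>

lemma posinormal_closed_range_funpow:
  assumes T: "bounded_operator smul T" "posinormal smul ip T" "closed (range T)"
    and "n \<ge> 1"
  shows "posinormal smul ip (T ^^ n) \<and> closed (range (T ^^ n))"
proof -
  obtain C where C: "C > 0" "\<And>x. x \<in> orth_ker T \<Longrightarrow> norm x \<le> C * norm (T x)"
    using closed_range_imp_bounded_below[OF T(1,3)] by blast
  \<comment> \<open>Since \<open>T\<close> maps into \<open>orth_ker T\<close>, its lower bound
    there can be iterated, each application contributing a factor \<open>C\<close>.\<close>
  have range_T: "T z \<in> orth_ker T" for z
    using posinormal_ker_orth_range[OF T(2)] by (simp add: orth_ker_def)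
  have below: "norm x \<le> C ^ k * norm ((T ^^ k) x)" if "x \<in> orth_ker T" for k x
    using that
  proof (induction k arbitrary: x)
    case (Suc k)
    have "norm x \<le> C * norm (T x)" by (rule C(2)[OF Suc.prems])
    also have "\<dots> \<le> C * (C ^ k * norm ((T ^^ k) (T x)))"
      using C(1) Suc.IH[OF range_T] by (intro mult_left_mono) auto
    finally show ?case by (simp add: funpow_swap1 mult.assoc)
  qed simp
  obtain k where n: "n = Suc k" using \<open>n \<ge> 1\<close> by (cases n) auto
  have Tn: "bounded_operator smul (T ^^ n)" by (rule bounded_operator_funpow[OF T(1)])
  have zero: "(T ^^ j) 0 = 0" for j
    using bounded_operator_imp_bounded_linear[OF bounded_operator_funpow[OF T(1)]]
    by (rule linear_simps(3))
  \<comment> \<open>After the first application \<open>T x\<close> is in \<open>orth_ker T\<close>,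
    where the remaining \<open>k\<close> applications are bounded below and so cannot send a nonzero
    vector to 0.\<close>
  have ker: "(T ^^ n) x = 0 \<longleftrightarrow> T x = 0" for x
    using below[OF range_T, of x k] zero by (auto simp: n funpow_swap1)
  then have "orth_ker (T ^^ n) = orth_ker T" by (simp add: orth_ker_def)
  then have "x \<in> orth_ker (T ^^ n) \<Longrightarrow> norm x \<le> C ^ n * norm ((T ^^ n) x)" for x
    using below by simp
  \<comment> \<open>As \<open>n = Suc k\<close>, the range of the power is contained in that of
    \<open>T\<close>, and its kernel is that of \<open>T\<close>, so orthogonality is
    inherited.\<close>
  moreover have "ip ((T ^^ n) z) x = 0" if "(T ^^ n) x = 0" for x z
    using posinormal_ker_orth_range[OF T(2)] that ker by (simp add: n)
  ultimately show ?thesis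
    using C(1) posinormal_if_ker_orth_range[OF Tn, of "C ^ n"]
      bounded_below_imp_closed_range[OF Tn, of "C ^ n"] by simp
qed

end

theorem mainTheorem1:
  fixes smul :: "'k::conj_field \<Rightarrow> 'a::banach \<Rightarrow> 'a"
    and ip :: "'a \<Rightarrow> 'a \<Rightarrow> 'k"
    and T :: "'a \<Rightarrow> 'a"
  assumes "hilbert_space smul ip"
    and "bounded_operator smul T"
    and "posinormal smul ip T"
    and "closed (range T)"
  shows "\<forall>n::nat. n \<ge> 1 \<longrightarrow> posinormal smul ip (T ^^ n) \<and> closed (range (T ^^ n))"
  using hilbert_space.posinormal_closed_range_funpow[OF assms] by blast

end
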